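(* Let $R$ be a ring and let ${}_l\mathfrak{F}_r$ be a symmetric filter for $R$. If ${}_l\mathfrak{F}_r$ is perfect, then it is differential.
   Context: Rings are associative with identity and modules are unital. Derivations. A derivation on a ring $R$ is an additive map $\delta:R\to R$ with $\delta(rs)=\delta(r)s+r\delta(s)$. Every derivation $\delta$ on $R$ determines a derivation $\overline{\delta}$ on $R\otimes_{\mathbb{Z}}R^{op}$ by $\overline{\delta}(r\otimes s)=\delta(r)\otimes s+r\otimes\delta(s)$. Symmetric filter. An $R$-bimodule $M$ is a right $R\otimes_{\mathbb{Z}}R^{op}$-module via $x(r\otimes s)=sxr$. If $\mathfrak{F}_l$ is a Gabriel filter of left ideals and $\mathfrak{F}_r$ a Gabriel filter of right ideals of $R$, the symmetric filter ${}_l\mathfrak{F}_r$ induced by them is the set of right ideals of $R\otimes_{\mathbb{Z}}R^{op}$ containing one of the form $J\otimes R^{op}+R\otimes I$ (the sum of the images in $R\otimes_{\mathbb{Z}}R^{op}$) with $I\in\mathfrak{F}_l$, $J\in\mathfrak{F}_r$. It is a Gabriel filter, with torsion submodule ${}_l\mathcal{T}_r(M)=\mathcal{T}_l(M)\cap\mathcal{T}_r(M)$, where $\mathcal{T}_l,\mathcal{T}_r$ are the torsion submodules for $\mathfrak{F}_l,\mathfrak{F}_r$. Symmetric ring of quotients. ${}_{\mathfrak{F}_l}R_{\mathfrak{F}_r}=\varinjlim_{K\in{}_l\mathfrak{F}_r}\mathrm{Hom}(K,R/{}_l\mathcal{T}_r(R))$ (homomorphisms of right $R\otimes_{\mathbb{Z}}R^{op}$-modules).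 It has a natural ring structure such that the canonical map $q_R:R\to{}_{\mathfrak{F}_l}R_{\mathfrak{F}_r}$, sending $m$ to the class of $t\mapsto(m+{}_l\mathcal{T}_r(R))t$, is a ring homomorphism. Perfect. A ring homomorphism $f:R\to S$ makes $S$ a perfect symmetric ring of quotients if the family of left ideals $\mathfrak{F}_l=\{I: Sf(I)=S\}$ is a left Gabriel filter, the family of right ideals $\mathfrak{F}_r=\{J: f(J)S=S\}$ is a right Gabriel filter, and there is a ring isomorphism $g:S\cong{}_{\mathfrak{F}_l}R_{\mathfrak{F}_r}$ such that $g\circ f=q_R$. In this case the symmetric filter ${}_l\mathfrak{F}_r$ induced by these $\mathfrak{F}_l$ and $\mathfrak{F}_r$ is called perfect. Differential. ${}_l\mathfrak{F}_r$ is differential if for every $I\in{}_l\mathfrak{F}_r$ there is $J\in{}_l\mathfrak{F}_r$ such that $\overline{\delta}(J)\subseteq I$ for all derivations $\overline{\delta}$ of the ring $R\otimes_{\mathbb{Z}}R^{op}$.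
   Formalization: "Differential" is read with J allowed to depend on the derivation (for every I and every derivation there is J); with one J for all derivations the claim fails, e.g. for the first Weyl algebra over Q in its division ring of fractions. *)

theory Defs
  imports "HOL-Algebra.Free_Abelian_Groups" "HOL-Algebra.QuotRing"
begin

section \<open>The tensor product over the integers\<close>

definition opposite_ring :: "('a, 'm) ring_scheme \<Rightarrow> ('a, 'm) ring_scheme"
  where "opposite_ring R = R\<lparr>mult := \<lambda>x y. y \<otimes>\<^bsub>R\<^esub> x\<rparr>"

text \<open>The integral monoid ring of the product of the multiplicative monoids of two rings: formal
  integer combinations of pairs, with the bilinear extension of \<open>(a, b) (c, d) = (a c, b d)\<close>.\<close>

definition pair_ring ::
    "('a, 'm) ring_scheme \<Rightarrow> ('b, 'n) ring_scheme \<Rightarrow> ('a \<times> 'b \<Rightarrow>\<^sub>0 int) ring"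
  where "pair_ring A B =
    \<lparr>carrier = carrier (free_Abelian_group (carrier A \<times> carrier B)),
     mult = (\<lambda>x y. frag_extend (\<lambda>(a, b).
               frag_extend (\<lambda>(c, d). frag_of (a \<otimes>\<^bsub>A\<^esub> c, b \<otimes>\<^bsub>B\<^esub> d)) y) x),
     one = frag_of (\<one>\<^bsub>A\<^esub>, \<one>\<^bsub>B\<^esub>),
     zero = 0,
     add = (+)\<rparr>"

definition bilinear_relators ::
    "('a, 'm) ring_scheme \<Rightarrow> ('b, 'n) ring_scheme \<Rightarrow> ('a \<times> 'b \<Rightarrow>\<^sub>0 int) set"
  where "bilinear_relators A B =
    {frag_of (a \<oplus>\<^bsub>A\<^esub> a', b) - frag_of (a, b) - frag_of (a', b) | a a' b.
       a \<in> carrier A \<and> a' \<in> carrier A \<and> b \<in> carrier B} \<union>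
    {frag_of (a, b \<oplus>\<^bsub>B\<^esub> b') - frag_of (a, b) - frag_of (a, b') | a b b'.
       a \<in> carrier A \<and> b \<in> carrier B \<and> b' \<in> carrier B}"

definition bilinear_subgroup ::
    "('a, 'm) ring_scheme \<Rightarrow> ('b, 'n) ring_scheme \<Rightarrow> ('a \<times> 'b \<Rightarrow>\<^sub>0 int) set"
  where "bilinear_subgroup A B =
    generate (free_Abelian_group (carrier A \<times> carrier B)) (bilinear_relators A B)"

definition tensor_ring ::
    "('a, 'm) ring_scheme \<Rightarrow> ('b, 'n) ring_scheme \<Rightarrow> ('a \<times> 'b \<Rightarrow>\<^sub>0 int) set ring"
  where "tensor_ring A B = pair_ring A B Quot bilinear_subgroup A B"

definition pure_tensor ::
    "('a, 'm) ring_scheme \<Rightarrow> ('b, 'n) ring_scheme \<Rightarrow> 'a \<Rightarrow> 'b \<Rightarrow> ('a \<times> 'b \<Rightarrow>\<^sub>0 int) set"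
  where "pure_tensor A B a b = bilinear_subgroup A B +>\<^bsub>pair_ring A B\<^esub> frag_of (a, b)"

text \<open>The image of \<open>X \<otimes> Y\<close> in \<open>A \<otimes> B\<close>, for additive subgroups \<open>X\<close> of \<open>A\<close> and \<open>Y\<close> of \<open>B\<close>.\<close>

definition tensor_image ::
    "('a, 'm) ring_scheme \<Rightarrow> ('b, 'n) ring_scheme \<Rightarrow> 'a set \<Rightarrow> 'b set \<Rightarrow>
      ('a \<times> 'b \<Rightarrow>\<^sub>0 int) set set"
  where "tensor_image A B X Y =
    generate (add_monoid (tensor_ring A B)) {pure_tensor A B x y | x y. x \<in> X \<and> y \<in> Y}"

type_synonym 'a env = "('a \<times> 'a \<Rightarrow>\<^sub>0 int) set"

abbreviation env_ring :: "('a, 'm) ring_scheme \<Rightarrow> 'a env ring"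
  where "env_ring R \<equiv> tensor_ring R (opposite_ring R)"

abbreviation env_pure :: "('a, 'm) ring_scheme \<Rightarrow> 'a \<Rightarrow> 'a \<Rightarrow> 'a env"
  where "env_pure R \<equiv> pure_tensor R (opposite_ring R)"


section \<open>Gabriel filters and symmetric filters\<close>

definition right_ideal :: "'a set \<Rightarrow> ('a, 'm) ring_scheme \<Rightarrow> bool"
  where "right_ideal J R \<longleftrightarrow>
    additive_subgroup J R \<and> (\<forall>x\<in>J. \<forall>r\<in>carrier R. x \<otimes>\<^bsub>R\<^esub> r \<in> J)"

definition left_ideal :: "'a set \<Rightarrow> ('a, 'm) ring_scheme \<Rightarrow> bool"
  where "left_ideal I R \<longleftrightarrow>
    additive_subgroup I R \<and> (\<forall>x\<in>I. \<forall>r\<in>carrier R. r \<otimes>\<^bsub>R\<^esub> x \<in> I)"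

definition right_colon :: "('a, 'm) ring_scheme \<Rightarrow> 'a set \<Rightarrow> 'a \<Rightarrow> 'a set"
  where "right_colon R J a = {r \<in> carrier R. a \<otimes>\<^bsub>R\<^esub> r \<in> J}"

definition left_colon :: "('a, 'm) ring_scheme \<Rightarrow> 'a set \<Rightarrow> 'a \<Rightarrow> 'a set"
  where "left_colon R I a = {r \<in> carrier R. r \<otimes>\<^bsub>R\<^esub> a \<in> I}"

definition right_gabriel_filter :: "('a, 'm) ring_scheme \<Rightarrow> 'a set set \<Rightarrow> bool"
  where "right_gabriel_filter R F \<longleftrightarrow>
    F \<noteq> {} \<and>
    (\<forall>J\<in>F. right_ideal J R) \<and>
    (\<forall>J\<in>F. \<forall>J'. right_ideal J' R \<and> J \<subseteq> J' \<longrightarrow> J' \<in> F) \<and>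
    (\<forall>J\<in>F. \<forall>J'\<in>F. J \<inter> J' \<in> F) \<and>
    (\<forall>J\<in>F. \<forall>a\<in>carrier R. right_colon R J a \<in> F) \<and>
    (\<forall>J\<in>F. \<forall>J'. right_ideal J' R \<and> (\<forall>a\<in>J. right_colon R J' a \<in> F) \<longrightarrow> J' \<in> F)"

definition left_gabriel_filter :: "('a, 'm) ring_scheme \<Rightarrow> 'a set set \<Rightarrow> bool"
  where "left_gabriel_filter R F \<longleftrightarrow>
    F \<noteq> {} \<and>
    (\<forall>I\<in>F. left_ideal I R) \<and>
    (\<forall>I\<in>F. \<forall>I'. left_ideal I' R \<and> I \<subseteq> I' \<longrightarrow> I' \<in> F) \<and>
    (\<forall>I\<in>F. \<forall>I'\<in>F. I \<inter> I' \<in> F) \<and>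
    (\<forall>I\<in>F. \<forall>a\<in>carrier R. left_colon R I a \<in> F) \<and>
    (\<forall>I\<in>F. \<forall>I'. left_ideal I' R \<and> (\<forall>a\<in>I. left_colon R I' a \<in> F) \<longrightarrow> I' \<in> F)"

definition induced_symmetric_filter ::
    "('a, 'm) ring_scheme \<Rightarrow> 'a set set \<Rightarrow> 'a set set \<Rightarrow> 'a env set set"
  where "induced_symmetric_filter R Fl Fr =
    {K. right_ideal K (env_ring R) \<and>
        (\<exists>I\<in>Fl. \<exists>J\<in>Fr.
           tensor_image R (opposite_ring R) J (carrier R) <+>\<^bsub>env_ring R\<^esub>
           tensor_image R (opposite_ring R) (carrier R) I \<subseteq> K)}"

definition symmetric_filter :: "('a, 'm) ring_scheme \<Rightarrow> 'a env set set \<Rightarrow> bool"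
  where "symmetric_filter R F \<longleftrightarrow>
    (\<exists>Fl Fr. left_gabriel_filter R Fl \<and> right_gabriel_filter R Fr \<and>
       F = induced_symmetric_filter R Fl Fr)"


section \<open>The symmetric ring of quotients\<close>

definition symmetric_torsion ::
    "('a, 'm) ring_scheme \<Rightarrow> 'a set set \<Rightarrow> 'a set set \<Rightarrow> 'a set"
  where "symmetric_torsion R Fl Fr =
    {x \<in> carrier R. {r \<in> carrier R. r \<otimes>\<^bsub>R\<^esub> x = \<zero>\<^bsub>R\<^esub>} \<in> Fl} \<inter>
    {x \<in> carrier R. {r \<in> carrier R. x \<otimes>\<^bsub>R\<^esub> r = \<zero>\<^bsub>R\<^esub>} \<in> Fr}"

text \<open>The action \<open>x (r \<otimes> s) = s x r\<close> of \<open>R \<otimes> R\<^sup>o\<^sup>p\<close> on the bimodule \<open>R / T\<close>: \<open>bimodule_frag_act\<close> is its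
  additive extension to formal combinations \<open>p\<close> of pairs \<open>(r, s)\<close>, and all representatives \<open>p\<close> of
  an element \<open>t\<close> of the tensor product give the same value.\<close>

definition bimodule_frag_act ::
    "('a, 'm) ring_scheme \<Rightarrow> 'a set \<Rightarrow> 'a set \<Rightarrow> ('a \<times> 'a \<Rightarrow>\<^sub>0 int) \<Rightarrow> 'a set"
  where "bimodule_frag_act R T x p =
    (\<Oplus>\<^bsub>R Quot T\<^esub>z \<in> Poly_Mapping.keys p.
       [Poly_Mapping.lookup p z] \<cdot>\<^bsub>R Quot T\<^esub>
         ((T +>\<^bsub>R\<^esub> snd z) \<otimes>\<^bsub>R Quot T\<^esub> x \<otimes>\<^bsub>R Quot T\<^esub> (T +>\<^bsub>R\<^esub> fst z)))"

definition bimodule_act ::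
    "('a, 'm) ring_scheme \<Rightarrow> 'a set \<Rightarrow> 'a set \<Rightarrow> 'a env \<Rightarrow> 'a set"
  where "bimodule_act R T x t = the_elem (bimodule_frag_act R T x ` t)"

definition env_hom ::
    "('a, 'm) ring_scheme \<Rightarrow> 'a set \<Rightarrow> 'a env set \<Rightarrow> ('a env \<Rightarrow> 'a set) set"
  where "env_hom R T K =
    {\<phi> \<in> K \<rightarrow>\<^sub>E carrier (R Quot T).
       (\<forall>x\<in>K. \<forall>y\<in>K. \<phi> (x \<oplus>\<^bsub>env_ring R\<^esub> y) = \<phi> x \<oplus>\<^bsub>R Quot T\<^esub> \<phi> y) \<and>
       (\<forall>x\<in>K. \<forall>t\<in>carrier (env_ring R).
          \<phi> (x \<otimes>\<^bsub>env_ring R\<^esub> t) = bimodule_act R T (\<phi> x) t)}"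

text \<open>The direct limit of the groups \<open>Hom (K, R / T)\<close>, with \<open>K\<close> in the symmetric filter: two
  homomorphisms are identified when they agree on a smaller member of the filter.\<close>

definition sym_quot_reps ::
    "('a, 'm) ring_scheme \<Rightarrow> 'a set set \<Rightarrow> 'a set set \<Rightarrow> ('a env set \<times> ('a env \<Rightarrow> 'a set)) set"
  where "sym_quot_reps R Fl Fr =
    (SIGMA K : induced_symmetric_filter R Fl Fr. env_hom R (symmetric_torsion R Fl Fr) K)"

definition sym_quot_rel ::
    "('a, 'm) ring_scheme \<Rightarrow> 'a set set \<Rightarrow> 'a set set \<Rightarrow>
      (('a env set \<times> ('a env \<Rightarrow> 'a set)) \<times> ('a env set \<times> ('a env \<Rightarrow> 'a set))) set"
  where "sym_quot_rel R Fl Fr =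
    {((K, \<phi>), (L, \<psi>)). (K, \<phi>) \<in> sym_quot_reps R Fl Fr \<and> (L, \<psi>) \<in> sym_quot_reps R Fl Fr \<and>
       (\<exists>H \<in> induced_symmetric_filter R Fl Fr. H \<subseteq> K \<inter> L \<and> (\<forall>t\<in>H. \<phi> t = \<psi> t))}"

type_synonym 'a sym_quot = "('a env set \<times> ('a env \<Rightarrow> 'a set)) set"

definition sym_quot_class ::
    "('a, 'm) ring_scheme \<Rightarrow> 'a set set \<Rightarrow> 'a set set \<Rightarrow> 'a env set \<Rightarrow> ('a env \<Rightarrow> 'a set) \<Rightarrow>
      'a sym_quot"
  where "sym_quot_class R Fl Fr K \<phi> = sym_quot_rel R Fl Fr `` {(K, \<phi>)}"

definition sym_quot_carrier ::
    "('a, 'm) ring_scheme \<Rightarrow> 'a set set \<Rightarrow> 'a set set \<Rightarrow> 'a sym_quot set"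
  where "sym_quot_carrier R Fl Fr = sym_quot_reps R Fl Fr // sym_quot_rel R Fl Fr"

definition sym_quot_map ::
    "('a, 'm) ring_scheme \<Rightarrow> 'a set set \<Rightarrow> 'a set set \<Rightarrow> 'a \<Rightarrow> 'a sym_quot"
  where "sym_quot_map R Fl Fr m =
    sym_quot_class R Fl Fr (carrier (env_ring R))
      (\<lambda>t \<in> carrier (env_ring R).
         bimodule_act R (symmetric_torsion R Fl Fr) (symmetric_torsion R Fl Fr +>\<^bsub>R\<^esub> m) t)"

definition sym_quot_add ::
    "('a, 'm) ring_scheme \<Rightarrow> 'a set set \<Rightarrow> 'a set set \<Rightarrow> 'a sym_quot \<Rightarrow> 'a sym_quot \<Rightarrow> 'a sym_quot"
  where "sym_quot_add R Fl Fr x y =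
    (\<Union>(K, \<phi>)\<in>x. \<Union>(L, \<psi>)\<in>y.
       sym_quot_class R Fl Fr (K \<inter> L)
         (\<lambda>t \<in> K \<inter> L. \<phi> t \<oplus>\<^bsub>R Quot symmetric_torsion R Fl Fr\<^esub> \<psi> t))"

text \<open>The right \<open>R \<otimes> R\<^sup>o\<^sup>p\<close>-module structure of the direct limit: the class of \<open>\<phi>\<close> times \<open>t\<close> is the
  class of \<open>k \<mapsto> \<phi> (t k)\<close>. So \<open>x (r \<otimes> 1)\<close> and \<open>x (1 \<otimes> s)\<close> are \<open>x r\<close> and \<open>s x\<close> in bimodule notation.\<close>

definition sym_quot_act ::
    "('a, 'm) ring_scheme \<Rightarrow> 'a set set \<Rightarrow> 'a set set \<Rightarrow> 'a sym_quot \<Rightarrow> 'a env \<Rightarrow> 'a sym_quot"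
  where "sym_quot_act R Fl Fr x t =
    (\<Union>(K, \<phi>)\<in>x.
       sym_quot_class R Fl Fr (right_colon (env_ring R) K t)
         (\<lambda>k \<in> right_colon (env_ring R) K t. \<phi> (t \<otimes>\<^bsub>env_ring R\<^esub> k)))"

text \<open>The natural product composes partial multiplications: if \<open>y r\<close> is the image of \<open>a \<in> R\<close> then
  \<open>(x y) r = x a\<close>, and if \<open>s x\<close> is the image of \<open>a \<in> R\<close> then \<open>s (x y) = a y\<close>. The first condition
  applies to a right ideal of \<open>r\<close> in \<open>Fr\<close> and the second one to a left ideal of \<open>s\<close> in \<open>Fl\<close>;
  the direct limit being torsion-free, at most one element satisfies both.\<close>

definition sym_quot_mult ::
    "('a, 'm) ring_scheme \<Rightarrow> 'a set set \<Rightarrow> 'a set set \<Rightarrow> 'a sym_quot \<Rightarrow> 'a sym_quot \<Rightarrow> 'a sym_quot"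
  where "sym_quot_mult R Fl Fr x y =
    (THE z. z \<in> sym_quot_carrier R Fl Fr \<and>
       (\<forall>r\<in>carrier R. \<forall>a\<in>carrier R.
          sym_quot_act R Fl Fr y (env_pure R r \<one>\<^bsub>R\<^esub>) = sym_quot_map R Fl Fr a \<longrightarrow>
          sym_quot_act R Fl Fr z (env_pure R r \<one>\<^bsub>R\<^esub>) =
            sym_quot_act R Fl Fr x (env_pure R a \<one>\<^bsub>R\<^esub>)) \<and>
       (\<forall>s\<in>carrier R. \<forall>a\<in>carrier R.
          sym_quot_act R Fl Fr x (env_pure R \<one>\<^bsub>R\<^esub> s) = sym_quot_map R Fl Fr a \<longrightarrow>
          sym_quot_act R Fl Fr z (env_pure R \<one>\<^bsub>R\<^esub> s) =
            sym_quot_act R Fl Fr y (env_pure R \<one>\<^bsub>R\<^esub> a)))"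

definition sym_quot_ring ::
    "('a, 'm) ring_scheme \<Rightarrow> 'a set set \<Rightarrow> 'a set set \<Rightarrow> 'a sym_quot ring"
  where "sym_quot_ring R Fl Fr =
    \<lparr>carrier = sym_quot_carrier R Fl Fr,
     mult = sym_quot_mult R Fl Fr,
     one = sym_quot_map R Fl Fr \<one>\<^bsub>R\<^esub>,
     zero = sym_quot_map R Fl Fr \<zero>\<^bsub>R\<^esub>,
     add = sym_quot_add R Fl Fr\<rparr>"


section \<open>Perfect filters\<close>

definition hom_left_filter ::
    "('a, 'm) ring_scheme \<Rightarrow> ('s, 'n) ring_scheme \<Rightarrow> ('a \<Rightarrow> 's) \<Rightarrow> 'a set set"
  where "hom_left_filter R S f =
    {I. left_ideal I R \<and>
        generate (add_monoid S) {s \<otimes>\<^bsub>S\<^esub> f i | s i. s \<in> carrier S \<and> i \<in> I} = carrier S}"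

definition hom_right_filter ::
    "('a, 'm) ring_scheme \<Rightarrow> ('s, 'n) ring_scheme \<Rightarrow> ('a \<Rightarrow> 's) \<Rightarrow> 'a set set"
  where "hom_right_filter R S f =
    {J. right_ideal J R \<and>
        generate (add_monoid S) {f j \<otimes>\<^bsub>S\<^esub> s | j s. j \<in> J \<and> s \<in> carrier S} = carrier S}"

definition perfect_symmetric_ring_of_quotients ::
    "('a, 'm) ring_scheme \<Rightarrow> ('s, 'n) ring_scheme \<Rightarrow> ('a \<Rightarrow> 's) \<Rightarrow> bool"
  where "perfect_symmetric_ring_of_quotients R S f \<longleftrightarrow>
    ring S \<and> f \<in> ring_hom R S \<and>
    left_gabriel_filter R (hom_left_filter R S f) \<and>
    right_gabriel_filter R (hom_right_filter R S f) \<and>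
    (\<exists>g \<in> ring_iso S (sym_quot_ring R (hom_left_filter R S f) (hom_right_filter R S f)).
       \<forall>r\<in>carrier R.
         g (f r) = sym_quot_map R (hom_left_filter R S f) (hom_right_filter R S f) r)"

text \<open>HOL cannot quantify over the type of \<open>S\<close> inside a definition; a statement about a free type
  \<open>'s\<close> under the hypothesis \<open>perfect_filter TYPE('s) R F\<close> covers every \<open>S\<close>.\<close>

definition perfect_filter :: "'s itself \<Rightarrow> ('a, 'm) ring_scheme \<Rightarrow> 'a env set set \<Rightarrow> bool"
  where "perfect_filter _ R F \<longleftrightarrow>
    (\<exists>(S :: 's ring) f. perfect_symmetric_ring_of_quotients R S f \<and>
       F = induced_symmetric_filter R (hom_left_filter R S f) (hom_right_filter R S f))"


section \<open>Differential filters\<close>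

definition derivation :: "('a, 'm) ring_scheme \<Rightarrow> ('a \<Rightarrow> 'a) \<Rightarrow> bool"
  where "derivation R \<delta> \<longleftrightarrow>
    \<delta> \<in> carrier R \<rightarrow> carrier R \<and>
    (\<forall>r\<in>carrier R. \<forall>s\<in>carrier R. \<delta> (r \<oplus>\<^bsub>R\<^esub> s) = \<delta> r \<oplus>\<^bsub>R\<^esub> \<delta> s) \<and>
    (\<forall>r\<in>carrier R. \<forall>s\<in>carrier R. \<delta> (r \<otimes>\<^bsub>R\<^esub> s) = \<delta> r \<otimes>\<^bsub>R\<^esub> s \<oplus>\<^bsub>R\<^esub> r \<otimes>\<^bsub>R\<^esub> \<delta> s)"

text \<open>\<open>J\<close> may depend on the derivation, as it does in the characterisation of differential torsion
  theories by \<open>d (T M) \<subseteq> T M\<close> for every module \<open>M\<close> and every derivation \<open>d\<close> of \<open>M\<close> over a derivation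
  of the ring. A \<open>J\<close> common to all derivations need not exist even for a perfect filter: take the
  inclusion of the first Weyl algebra over the rationals in its division ring of fractions, with
  inner derivations.\<close>

definition differential_filter :: "('a, 'm) ring_scheme \<Rightarrow> 'a env set set \<Rightarrow> bool"
  where "differential_filter R F \<longleftrightarrow>
    (\<forall>I\<in>F. \<forall>\<delta>. derivation (env_ring R) \<delta> \<longrightarrow> (\<exists>J\<in>F. \<delta> ` J \<subseteq> I))"

end

theory Submission
  imports Defs
begin

text \<open>For \<open>K\<close> in a Gabriel filter and a derivation \<open>\<delta>\<close>, the set \<open>L = {x \<in> K. \<delta> x \<in> K}\<close> is a right
  ideal by the Leibniz rule, and for \<open>a \<in> K\<close> the identity \<open>\<delta> (a r) = \<delta> a r + a \<delta> r\<close> shows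
  \<open>(K : \<delta> a) \<subseteq> (L : a)\<close>. So all these colon ideals, hence \<open>L\<close>, belong to the filter. For a symmetric
  filter the argument is carried out for the preimages of \<open>L\<close> under \<open>r \<mapsto> r \<otimes> 1\<close> and \<open>s \<mapsto> 1 \<otimes> s\<close>,
  within the one-sided filters of \<open>R\<close> and \<open>R\<^sup>o\<^sup>p\<close>; left ideals are treated as right ideals of the
  opposite ring.\<close>

section \<open>The tensor product ring\<close>

lemma generate_subset_additive_subgroup:
  assumes "abelian_group G" "additive_subgroup H G" "K \<subseteq> H"
  shows "generate (add_monoid G) K \<subseteq> H"
  by (rule group.generate_subgroup_incl)
    (use assms in \<open>auto simp: abelian_group.a_group additive_subgroup.a_subgroup\<close>)

lemma ring_opposite_ring:
  assumes "ring R"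
  shows "ring (opposite_ring R)"
proof -
  interpret ring R by fact
  have "abelian_group (opposite_ring R)"
    by (rule abelian_groupI) (auto simp: opposite_ring_def a_ac intro: l_neg)
  moreover have "Group.monoid (opposite_ring R)"
    by (rule monoidI) (auto simp: opposite_ring_def m_assoc)
  ultimately show ?thesis
    by (rule ringI) (auto simp: opposite_ring_def l_distr r_distr)
qed

lemma opposite_ring_simps [simp]:
  "carrier (opposite_ring R) = carrier R"
  "mult (opposite_ring R) x y = y \<otimes>\<^bsub>R\<^esub> x"
  "one (opposite_ring R) = \<one>\<^bsub>R\<^esub>"
  "zero (opposite_ring R) = \<zero>\<^bsub>R\<^esub>"
  "add (opposite_ring R) = add R"
  by (simp_all add: opposite_ring_def)

section \<open>The ring of formal integer combinations of pairs\<close>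

lemma pair_ring_simps [simp]:
  "x \<in> carrier (pair_ring A B) \<longleftrightarrow> Poly_Mapping.keys x \<subseteq> carrier A \<times> carrier B"
  "one (pair_ring A B) = frag_of (\<one>\<^bsub>A\<^esub>, \<one>\<^bsub>B\<^esub>)"
  "zero (pair_ring A B) = 0"
  "x \<oplus>\<^bsub>pair_ring A B\<^esub> y = x + y"
  by (simp_all add: pair_ring_def)

lemma pair_mult_diff_left:
  "(x - y) \<otimes>\<^bsub>pair_ring A B\<^esub> z = x \<otimes>\<^bsub>pair_ring A B\<^esub> z - y \<otimes>\<^bsub>pair_ring A B\<^esub> z"
  by (simp add: pair_ring_def frag_extend_diff)

text \<open>The right factor sits inside the inner \<open>frag_extend\<close>, so linearity in it is
  not immediate from the definition; it is checked on generators \<open>z\<close> and carried over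
  to differences by linearity in the left factor.\<close>

lemma pair_mult_diff_right:
  "z \<otimes>\<^bsub>pair_ring A B\<^esub> (x - y) = z \<otimes>\<^bsub>pair_ring A B\<^esub> x - z \<otimes>\<^bsub>pair_ring A B\<^esub> y"
proof -
  \<comment> \<open>Bounding the support by \<open>UNIV\<close> lets \<open>frag_induction\<close>
    run without any carrier hypothesis on \<open>z\<close>.\<close>
  have "Poly_Mapping.keys z \<subseteq> UNIV" by simp
  then show ?thesis
    by (induction z rule: frag_induction)
      (auto simp: pair_ring_def frag_extend_diff)
qed

lemma pair_mult_zero [simp]:
  "0 \<otimes>\<^bsub>pair_ring A B\<^esub> x = 0"
  "x \<otimes>\<^bsub>pair_ring A B\<^esub> 0 = 0"
  using pair_mult_diff_left[where x = 0 and y = 0] pair_mult_diff_right[where x = 0 and y = 0]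
      by auto

text \<open>Sums are recovered from differences by writing \<open>x\<close> as
  \<open>(x + y) - y\<close>. Differences come first because they are the inductive step of
  \<open>frag_induction\<close>.\<close>

lemma pair_mult_add:
  "(x + y) \<otimes>\<^bsub>pair_ring A B\<^esub> z = x \<otimes>\<^bsub>pair_ring A B\<^esub> z + y \<otimes>\<^bsub>pair_ring A B\<^esub> z"
  "z \<otimes>\<^bsub>pair_ring A B\<^esub> (x + y) = z \<otimes>\<^bsub>pair_ring A B\<^esub> x + z \<otimes>\<^bsub>pair_ring A B\<^esub> y"
  using pair_mult_diff_left[where x = "x + y" and y = y and z = z and A = A and B = B]
    pair_mult_diff_right[where x = "x + y" and y = y and z = z and A = A and B = B]
  by (simp_all add: eq_diff_eq)

lemma pair_mult_of [simp]:
  "frag_of (a, b) \<otimes>\<^bsub>pair_ring A B\<^esub> frag_of (c, d) = frag_of (a \<otimes>\<^bsub>A\<^esub> c, b \<otimes>\<^bsub>B\<^esub> d)"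
  by (simp add: pair_ring_def)

context
  fixes A :: "('a, 'm) ring_scheme" and B :: "('b, 'n) ring_scheme"
  assumes rings: "ring A" "ring B"
begin

interpretation A: ring A by (fact rings)
interpretation B: ring B by (fact rings)

text \<open>Double induction on the factors: a product of two generators is a generator, and the
  support of a difference lies in the union of the supports.\<close>

lemma pair_mult_closed:
  assumes "Poly_Mapping.keys x \<subseteq> carrier A \<times> carrier B"
      "Poly_Mapping.keys y \<subseteq> carrier A \<times> carrier B"
  shows "Poly_Mapping.keys (x \<otimes>\<^bsub>pair_ring A B\<^esub> y) \<subseteq> carrier A \<times> carrier B"
  using assms(1)
proof (induction x rule: frag_induction)
  case (one p)
  show ?case
    using assms(2)
  proof (induction y rule: frag_induction)
    case (one q)
    then show ?case
      using \<open>p \<in> carrier A \<times> carrier B\<close> by (cases p; cases q) auto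
  next
    case (diff u v)
    then show ?case
      unfolding pair_mult_diff_right by (intro order_trans[OF keys_diff] Un_least)
  qed simp
next
  case (diff u v)
  then show ?case
    unfolding pair_mult_diff_left by (intro order_trans[OF keys_diff] Un_least)
qed simp

text \<open>Both sides are additive in each argument, so three nested inductions reduce the law to
  generators, where it holds coordinatewise.\<close>

lemma pair_mult_assoc:
  assumes "Poly_Mapping.keys x \<subseteq> carrier A \<times> carrier B"
      "Poly_Mapping.keys y \<subseteq> carrier A \<times> carrier B" "Poly_Mapping.keys z \<subseteq> carrier A \<times> carrier B"
  shows "x \<otimes>\<^bsub>pair_ring A B\<^esub> y \<otimes>\<^bsub>pair_ring A B\<^esub> z = x \<otimes>\<^bsub>pair_ring A B\<^esub> (y \<otimes>\<^bsub>pair_ring A B\<^esub> z)"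
  using assms(1)
proof (induction x rule: frag_induction)
  case (one p)
  show ?case
    using assms(2)
  proof (induction y rule: frag_induction)
    case (one q)
    show ?case
      using assms(3)
    proof (induction z rule: frag_induction)
      case (one r)
      then show ?case
        using \<open>p \<in> carrier A \<times> carrier B\<close> \<open>q \<in> carrier A \<times> carrier B\<close>
            by (cases p; cases q; cases r) (auto simp: A.m_assoc B.m_assoc)
    qed (simp_all add: pair_mult_diff_right)
  qed (simp_all add: pair_mult_diff_left pair_mult_diff_right)
qed (simp_all add: pair_mult_diff_left)

lemma pair_mult_one:
  assumes "Poly_Mapping.keys x \<subseteq> carrier A \<times> carrier B"
  shows "frag_of (\<one>\<^bsub>A\<^esub>, \<one>\<^bsub>B\<^esub>) \<otimes>\<^bsub>pair_ring A B\<^esub> x = x" "x \<otimes>\<^bsub>pair_ring A B\<^esub> frag_of (\<one>\<^bsub>A\<^esub>, \<one>\<^bsub>B\<^esub>) = x"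
  using assms
  by (induction x rule: frag_induction; auto simp: pair_mult_diff_left pair_mult_diff_right)+

lemma ring_pair_ring: "ring (pair_ring A B)"
proof (rule ringI)
  show "abelian_group (pair_ring A B)"
  proof (rule abelian_groupI)
    fix x assume "x \<in> carrier (pair_ring A B)"
    then show "\<exists>y\<in>carrier (pair_ring A B). y \<oplus>\<^bsub>pair_ring A B\<^esub> x = \<zero>\<^bsub>pair_ring A B\<^esub>"
      by (intro bexI[of _ "- x"]) auto
  qed (auto simp: add_ac dest: subsetD[OF keys_add])
  show "Group.monoid (pair_ring A B)"
    by (rule monoidI) (simp_all add: pair_mult_assoc pair_mult_one pair_mult_closed)
qed (simp_all add: pair_mult_add)

section \<open>The ideal of bilinear relations\<close>

lemma add_monoid_pair_ring: "free_Abelian_group (carrier A \<times> carrier B) =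
    add_monoid (pair_ring A B)"
  by (simp add: pair_ring_def free_Abelian_group_def)

lemma bilinear_relators_carrier:
    "bilinear_relators A B \<subseteq> carrier (free_Abelian_group (carrier A \<times> carrier B))"
  unfolding bilinear_relators_def by (force dest!: subsetD[OF keys_diff])

lemma bilinear_subgroup_diff:
  assumes "x \<in> bilinear_subgroup A B" "y \<in> bilinear_subgroup A B"
  shows "x - y \<in> bilinear_subgroup A B"
proof -
  interpret G: group "free_Abelian_group (carrier A \<times> carrier B)" by simp
  have sub: "subgroup (bilinear_subgroup A B) (free_Abelian_group (carrier A \<times> carrier B))"
    unfolding bilinear_subgroup_def by (rule G.generate_is_subgroup[OF bilinear_relators_carrier])
  \<comment> \<open>The group inverse evaluates to \<open>- y\<close> for elements of the carrier,
    hence this membership.\<close>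
  have "y \<in> carrier (free_Abelian_group (carrier A \<times> carrier B))"
    using sub assms(2) subgroup.subset by blast
  then show ?thesis
    using subgroup.m_closed[OF sub assms(1) subgroup.m_inv_closed[OF sub assms(2)]] by simp
qed

lemma bilinear_subgroup_zero: "0 \<in> bilinear_subgroup A B"
  unfolding bilinear_subgroup_def
  by (metis generate.one one_free_Abelian_group)

lemma bilinear_relator_left:
  assumes "a \<in> carrier A" "a' \<in> carrier A" "b \<in> carrier B"
  shows "frag_of (a \<oplus>\<^bsub>A\<^esub> a', b) - frag_of (a, b) - frag_of (a', b) \<in> bilinear_relators A B"
  using assms unfolding bilinear_relators_def by blast

lemma bilinear_relator_right:
  assumes "a \<in> carrier A" "b \<in> carrier B" "b' \<in> carrier B"
  shows "frag_of (a, b \<oplus>\<^bsub>B\<^esub> b') - frag_of (a, b) - frag_of (a, b') \<in> bilinear_relators A B"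
  using assms unfolding bilinear_relators_def by blast

text \<open>Multiplication by a pair sends a relator to a relator of the same type: distributivity
  in the coordinate that carries the sum gives a sum again, and the other coordinate is just
  multiplied.\<close>

lemma bilinear_subgroup_mult_of:
  assumes "h \<in> bilinear_relators A B" "p \<in> carrier A \<times> carrier B"
  shows "frag_of p \<otimes>\<^bsub>pair_ring A B\<^esub> h \<in> bilinear_subgroup A B"
      "h \<otimes>\<^bsub>pair_ring A B\<^esub> frag_of p \<in> bilinear_subgroup A B"
proof -
  obtain c d where p: "p = (c, d)" "c \<in> carrier A" "d \<in> carrier B"
    using assms(2) by auto
  consider a a' b where "a \<in> carrier A" "a' \<in> carrier A" "b \<in> carrier B"
      "h = frag_of (a \<oplus>\<^bsub>A\<^esub> a', b) - frag_of (a, b) - frag_of (a', b)"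
    | a b b' where "a \<in> carrier A" "b \<in> carrier B" "b' \<in> carrier B"
      "h = frag_of (a, b \<oplus>\<^bsub>B\<^esub> b') - frag_of (a, b) - frag_of (a, b')"
    using assms(1) unfolding bilinear_relators_def by blast
  then have "frag_of p \<otimes>\<^bsub>pair_ring A B\<^esub> h \<in> bilinear_relators A B \<and>
    h \<otimes>\<^bsub>pair_ring A B\<^esub> frag_of p \<in> bilinear_relators A B"
  proof cases
    case (1 a a' b)
    then show ?thesis
      using p bilinear_relator_left[of "c \<otimes>\<^bsub>A\<^esub> a" "c \<otimes>\<^bsub>A\<^esub> a'" "d \<otimes>\<^bsub>B\<^esub> b"]
        bilinear_relator_left[of "a \<otimes>\<^bsub>A\<^esub> c" "a' \<otimes>\<^bsub>A\<^esub> c" "b \<otimes>\<^bsub>B\<^esub> d"]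
      by (simp add: pair_mult_diff_left pair_mult_diff_right A.l_distr A.r_distr)
  next
    case (2 a b b')
    then show ?thesis
      using p bilinear_relator_right[of "c \<otimes>\<^bsub>A\<^esub> a" "d \<otimes>\<^bsub>B\<^esub> b" "d \<otimes>\<^bsub>B\<^esub> b'"]
        bilinear_relator_right[of "a \<otimes>\<^bsub>A\<^esub> c" "b \<otimes>\<^bsub>B\<^esub> d" "b' \<otimes>\<^bsub>B\<^esub> d"]
      by (simp add: pair_mult_diff_left pair_mult_diff_right B.l_distr B.r_distr)
  qed
  then show "frag_of p \<otimes>\<^bsub>pair_ring A B\<^esub> h \<in> bilinear_subgroup A B"
      "h \<otimes>\<^bsub>pair_ring A B\<^esub> frag_of p \<in> bilinear_subgroup A B"
    unfolding bilinear_subgroup_def by (auto intro: generate.incl)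
qed

text \<open>Recasts \<open>generate.induct\<close> with subtraction as the only operation: the
  inverse of a generator is \<open>0 - h\<close>, and a sum is \<open>h1 - (0 - h2)\<close>.\<close>

lemma bilinear_subgroup_induct [consumes 1, case_names zero relator diff]:
  assumes "h \<in> bilinear_subgroup A B" "Q 0" "\<And>h. h \<in> bilinear_relators A B \<Longrightarrow> Q h"
    "\<And>x y. Q x \<Longrightarrow> Q y \<Longrightarrow> Q (x - y)"
  shows "Q h"
  using assms(1) unfolding bilinear_subgroup_def
proof (induction h rule: generate.induct)
  case (inv h)
  then have "inv\<^bsub>free_Abelian_group (carrier A \<times> carrier B)\<^esub> h = 0 - h"
    using subsetD[OF bilinear_relators_carrier] by simp
  with inv assms show ?case by metis
next
  case (eng h1 h2)
  have "Q (h1 - (0 - h2))"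
    by (intro assms eng)
  then show ?case by simp
qed (use assms in auto)

text \<open>Absorption is biadditive in the ring element and the subgroup element; one induction on
  each reduces it to a single pair times a single relator.\<close>

lemma ideal_bilinear_subgroup: "ideal (bilinear_subgroup A B) (pair_ring A B)"
proof (rule idealI[OF ring_pair_ring])
  have "group (free_Abelian_group (carrier A \<times> carrier B))" by simp
  from group.generate_is_subgroup[OF this bilinear_relators_carrier]
  show "subgroup (bilinear_subgroup A B) (add_monoid (pair_ring A B))"
    by (simp add: bilinear_subgroup_def add_monoid_pair_ring)
next
  fix h x assume h: "h \<in> bilinear_subgroup A B" and "x \<in> carrier (pair_ring A B)"
  then have x: "Poly_Mapping.keys x \<subseteq> carrier A \<times> carrier B" by simp
  show "x \<otimes>\<^bsub>pair_ring A B\<^esub> h \<in> bilinear_subgroup A B"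
    using x
  proof (induction x rule: frag_induction)
    case (one p)
    show ?case
      using h by (induction h rule: bilinear_subgroup_induct)
        (auto simp: one pair_mult_diff_right bilinear_subgroup_zero
          intro: bilinear_subgroup_diff bilinear_subgroup_mult_of)
  qed (auto simp: pair_mult_diff_left bilinear_subgroup_zero intro: bilinear_subgroup_diff)
  show "h \<otimes>\<^bsub>pair_ring A B\<^esub> x \<in> bilinear_subgroup A B"
    using x
  proof (induction x rule: frag_induction)
    case (one p)
    show ?case
      using h by (induction h rule: bilinear_subgroup_induct)
        (auto simp: one pair_mult_diff_left bilinear_subgroup_zero
          intro: bilinear_subgroup_diff bilinear_subgroup_mult_of)
  qed (auto simp: pair_mult_diff_right bilinear_subgroup_zero intro: bilinear_subgroup_diff)
qed

section \<open>The quotient ring and its pure tensors\<close>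

lemma ring_tensor_ring: "ring (tensor_ring A B)"
  unfolding tensor_ring_def by (rule ideal.quotient_is_ring[OF ideal_bilinear_subgroup])

lemma coset_ring_hom: "(+>\<^bsub>pair_ring A B\<^esub>) (bilinear_subgroup A B)
    \<in> ring_hom (pair_ring A B) (tensor_ring A B)"
  unfolding tensor_ring_def by (rule ideal.rcos_ring_hom[OF ideal_bilinear_subgroup])

lemma pure_tensor_closed:
  assumes "a \<in> carrier A" "b \<in> carrier B"
  shows "pure_tensor A B a b \<in> carrier (tensor_ring A B)"
  unfolding pure_tensor_def using assms
  by (intro ring_hom_closed[OF coset_ring_hom]) auto

lemma pure_tensor_mult:
  assumes "a \<in> carrier A" "b \<in> carrier B" "c \<in> carrier A" "d \<in> carrier B"
  shows "pure_tensor A B a b \<otimes>\<^bsub>tensor_ring A B\<^esub> pure_tensor A B c d =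
    pure_tensor A B (a \<otimes>\<^bsub>A\<^esub> c) (b \<otimes>\<^bsub>B\<^esub> d)"
  unfolding pure_tensor_def using assms
  by (subst ring_hom_mult[OF coset_ring_hom, symmetric]) auto

lemma pure_tensor_one: "pure_tensor A B \<one>\<^bsub>A\<^esub> \<one>\<^bsub>B\<^esub> = \<one>\<^bsub>tensor_ring A B\<^esub>"
  using ring_hom_one[OF coset_ring_hom] by (simp add: pure_tensor_def)

text \<open>Turns a relator into an equation of cosets: \<open>x\<close> and \<open>y + z\<close>
  differ by an element of the subgroup, and the coset map is additive.\<close>

lemma coset_eqI:
  assumes "x - y - z \<in> bilinear_subgroup A B"
    and "Poly_Mapping.keys x \<subseteq> carrier A \<times> carrier B" "Poly_Mapping.keys y \<subseteq> carrier A \<times> carrier B"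
        "Poly_Mapping.keys z \<subseteq> carrier A \<times> carrier B"
  shows "bilinear_subgroup A B +>\<^bsub>pair_ring A B\<^esub> x = (bilinear_subgroup A B +>\<^bsub>pair_ring A B\<^esub> y)
      \<oplus>\<^bsub>tensor_ring A B\<^esub> (bilinear_subgroup A B +>\<^bsub>pair_ring A B\<^esub> z)"
proof -
  interpret N: ideal "bilinear_subgroup A B" "pair_ring A B" by (rule ideal_bilinear_subgroup)
  have yz: "Poly_Mapping.keys (y + z) \<subseteq> carrier A \<times> carrier B"
    using assms(3,4) keys_add[of y z] by blast
  have "x \<in> bilinear_subgroup A B +>\<^bsub>pair_ring A B\<^esub> (y + z)"
    unfolding a_r_coset_def' using assms(1) by (auto intro!: bexI[of _ "x - y - z"])
  then have "bilinear_subgroup A B +>\<^bsub>pair_ring A B\<^esub> x =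
      bilinear_subgroup A B +>\<^bsub>pair_ring A B\<^esub> (y + z)"
    using yz by (intro N.a_repr_independence'[symmetric]) (simp_all only: pair_ring_simps)
  also have "\<dots> = (bilinear_subgroup A B +>\<^bsub>pair_ring A B\<^esub> y)
      \<oplus>\<^bsub>tensor_ring A B\<^esub> (bilinear_subgroup A B +>\<^bsub>pair_ring A B\<^esub> z)"
    using ring_hom_add[OF coset_ring_hom, of y z] assms(3,4) unfolding pair_ring_simps .
  finally show ?thesis .
qed

lemma pure_tensor_add_left:
  assumes "a \<in> carrier A" "a' \<in> carrier A" "b \<in> carrier B"
  shows "pure_tensor A B (a \<oplus>\<^bsub>A\<^esub> a') b = pure_tensor A B a b
      \<oplus>\<^bsub>tensor_ring A B\<^esub> pure_tensor A B a' b"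
  unfolding pure_tensor_def
proof (rule coset_eqI)
  show "frag_of (a \<oplus>\<^bsub>A\<^esub> a', b) - frag_of (a, b) - frag_of (a', b) \<in> bilinear_subgroup A B"
    unfolding bilinear_subgroup_def using assms by (intro generate.incl bilinear_relator_left)
qed (use assms in auto)

lemma pure_tensor_add_right:
  assumes "a \<in> carrier A" "b \<in> carrier B" "b' \<in> carrier B"
  shows "pure_tensor A B a (b \<oplus>\<^bsub>B\<^esub> b') = pure_tensor A B a b
      \<oplus>\<^bsub>tensor_ring A B\<^esub> pure_tensor A B a b'"
  unfolding pure_tensor_def
proof (rule coset_eqI)
  show "frag_of (a, b \<oplus>\<^bsub>B\<^esub> b') - frag_of (a, b) - frag_of (a, b') \<in> bilinear_subgroup A B"
    unfolding bilinear_subgroup_def using assms by (intro generate.incl bilinear_relator_right)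
qed (use assms in auto)

text \<open>Along this map and its counterpart on \<open>B\<close>, ideals of the tensor product are
  pulled back to the rings on which the one-sided filters live.\<close>

lemma pure_tensor_left_hom: "(\<lambda>a. pure_tensor A B a \<one>\<^bsub>B\<^esub>) \<in> ring_hom A (tensor_ring A B)"
  by (rule ring_hom_memI)
    (auto simp: pure_tensor_closed pure_tensor_mult pure_tensor_add_left pure_tensor_one)

lemma pure_tensor_right_hom: "(\<lambda>b. pure_tensor A B \<one>\<^bsub>A\<^esub> b) \<in> ring_hom B (tensor_ring A B)"
  by (rule ring_hom_memI)
    (auto simp: pure_tensor_closed pure_tensor_mult pure_tensor_add_right pure_tensor_one)

text \<open>Every element is the coset of a formal combination, so the induction for free abelian
  groups passes to the quotient. The carrier memberships in the difference case make the ring laws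
  available there.\<close>

lemma tensor_ring_induct [consumes 1, case_names zero pure diff]:
  assumes "t \<in> carrier (tensor_ring A B)" "Q \<zero>\<^bsub>tensor_ring A B\<^esub>"
    and pure: "\<And>a b. a \<in> carrier A \<Longrightarrow> b \<in> carrier B \<Longrightarrow> Q (pure_tensor A B a b)"
    and minus: "\<And>x y. \<lbrakk>x \<in> carrier (tensor_ring A B); y \<in> carrier (tensor_ring A B); Q x; Q y\<rbrakk>
        \<Longrightarrow> Q (x \<ominus>\<^bsub>tensor_ring A B\<^esub> y)"
  shows "Q t"
proof -
  interpret h: ring_hom_ring "pair_ring A B" "tensor_ring A B"
      "(+>\<^bsub>pair_ring A B\<^esub>) (bilinear_subgroup A B)"
    by (intro ring_hom_ringI2 ring_pair_ring ring_tensor_ring coset_ring_hom)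
  obtain c where c: "c \<in> carrier (pair_ring A B)" and t: "t =
      bilinear_subgroup A B +>\<^bsub>pair_ring A B\<^esub> c"
    using assms(1)
        unfolding tensor_ring_def FactRing_def A_RCOSETS_def' partial_object.simps by blast
  have "Q (bilinear_subgroup A B +>\<^bsub>pair_ring A B\<^esub> c)"
    if "Poly_Mapping.keys c \<subseteq> carrier A \<times> carrier B" for c
    using that
  proof (induction c rule: free_Abelian_group_induct[consumes 1, case_names zero diff of])
    case zero
    show ?case using assms(2) h.hom_zero by simp
  next
    case (diff x y)
    \<comment> \<open>The homomorphism rules speak of the ring inverse, while the induction produces
      the subtraction of formal combinations.\<close>
    have y: "\<ominus>\<^bsub>pair_ring A B\<^esub> y = - y"
      using diff.hyps diff.IH by (intro h.R.minus_equality) auto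
    have "bilinear_subgroup A B +>\<^bsub>pair_ring A B\<^esub> (x - y) =
        (bilinear_subgroup A B +>\<^bsub>pair_ring A B\<^esub> x)
        \<ominus>\<^bsub>tensor_ring A B\<^esub> (bilinear_subgroup A B +>\<^bsub>pair_ring A B\<^esub> y)"
      using diff.hyps diff.IH h.hom_add[of x "- y"] h.hom_a_inv[of y] y by (simp add: a_minus_def)
    then show ?case
      using diff.hyps diff.IH minus[of "bilinear_subgroup A B +>\<^bsub>pair_ring A B\<^esub> x"
          "bilinear_subgroup A B +>\<^bsub>pair_ring A B\<^esub> y"] h.hom_closed by simp
  next
    case (of p)
    then show ?case
      using pure by (cases p) (auto simp: pure_tensor_def)
  qed
  then show ?thesis
    using c t by simp
qed

end

section \<open>Gabriel filters and derivations\<close>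

lemma left_ideal_eq_right_ideal: "left_ideal I R = right_ideal I (opposite_ring R)"
  by (simp add: left_ideal_def right_ideal_def additive_subgroup_def)

lemma left_gabriel_filter_eq: "left_gabriel_filter R F = right_gabriel_filter (opposite_ring R) F"
  by (simp add: left_gabriel_filter_def right_gabriel_filter_def left_ideal_eq_right_ideal
      left_colon_def right_colon_def)

lemma right_idealD:
  assumes "right_ideal J R"
  shows "additive_subgroup J R" "\<And>x r. x \<in> J \<Longrightarrow> r \<in> carrier R \<Longrightarrow> x \<otimes>\<^bsub>R\<^esub> r \<in> J"
  using assms by (auto simp: right_ideal_def)

text \<open>The axioms are cited below by position: (3) upward closure, (4) intersections, (5) colon
  ideals, (6) the local criterion that tests an ideal through its colon ideals.\<close>

lemma right_gabriel_filterD: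
  assumes "right_gabriel_filter R F"
  shows "F \<noteq> {}"
    and "\<And>J. J \<in> F \<Longrightarrow> right_ideal J R"
    and "\<And>J J'. \<lbrakk>J \<in> F; J \<subseteq> J'; right_ideal J' R\<rbrakk> \<Longrightarrow> J' \<in> F"
    and "\<And>J J'. J \<in> F \<Longrightarrow> J' \<in> F \<Longrightarrow> J \<inter> J' \<in> F"
    and "\<And>J a. J \<in> F \<Longrightarrow> a \<in> carrier R \<Longrightarrow> right_colon R J a \<in> F"
    and "\<And>J J'. \<lbrakk>J \<in> F; right_ideal J' R; \<And>a. a \<in> J \<Longrightarrow> right_colon R J' a \<in> F\<rbrakk> \<Longrightarrow> J' \<in> F"
proof -
  note D = assms[unfolded right_gabriel_filter_def]
  show "F \<noteq> {}" by (rule D[THEN conjunct1])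
  note D = D[THEN conjunct2]
  show "right_ideal J R" if "J \<in> F" for J
    using D[THEN conjunct1] that by blast
  note D = D[THEN conjunct2]
  show "J' \<in> F" if "J \<in> F" "J \<subseteq> J'" "right_ideal J' R" for J J'
    using D[THEN conjunct1] that by blast
  note D = D[THEN conjunct2]
  show "J \<inter> J' \<in> F" if "J \<in> F" "J' \<in> F" for J J'
    using D[THEN conjunct1] that by blast
  note D = D[THEN conjunct2]
  show "right_colon R J a \<in> F" if "J \<in> F" "a \<in> carrier R" for J a
    using D[THEN conjunct1] that by blast
  show "J' \<in> F" if "J \<in> F" "right_ideal J' R" "\<And>a. a \<in> J \<Longrightarrow> right_colon R J' a \<in> F" for J J'
    using D[THEN conjunct2] that by blast
qed

lemma right_idealI:
  assumes "abelian_group R" "I \<subseteq> carrier R" "I \<noteq> {}"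
    and "\<And>x y. x \<in> I \<Longrightarrow> y \<in> I \<Longrightarrow> x \<ominus>\<^bsub>R\<^esub> y \<in> I"
    and "\<And>x r. x \<in> I \<Longrightarrow> r \<in> carrier R \<Longrightarrow> x \<otimes>\<^bsub>R\<^esub> r \<in> I"
  shows "right_ideal I R"
proof -
  interpret abelian_group R by fact
  have zero: "\<zero>\<^bsub>R\<^esub> \<in> I"
  proof -
    obtain x where x: "x \<in> I" using assms(3) by blast
    then show ?thesis
      using assms(2) assms(4)[OF x x] by (auto simp: minus_eq r_neg)
  qed
  have inv: "\<ominus>\<^bsub>R\<^esub> x \<in> I" if "x \<in> I" for x
    using assms(2) assms(4)[OF zero that] that by (auto simp: minus_eq)
  have "x \<oplus>\<^bsub>R\<^esub> y \<in> I" if "x \<in> I" "y \<in> I" for x y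
    using assms(2) assms(4)[OF that(1) inv[OF that(2)]] that by (auto simp: minus_eq)
  then have "subgroup I (add_monoid R)"
    using zero inv assms(2) by (intro subgroup.intro) (auto simp: a_inv_def)
  then show ?thesis
    using assms(5) by (simp add: right_ideal_def additive_subgroup_def)
qed

section \<open>Derivations and right ideals\<close>

lemma derivationD:
  assumes "derivation R \<delta>"
  shows "\<And>r. r \<in> carrier R \<Longrightarrow> \<delta> r \<in> carrier R"
    and "\<And>r s. \<lbrakk>r \<in> carrier R; s \<in> carrier R\<rbrakk> \<Longrightarrow> \<delta> (r \<oplus>\<^bsub>R\<^esub> s) = \<delta> r \<oplus>\<^bsub>R\<^esub> \<delta> s"
    and "\<And>r s. \<lbrakk>r \<in> carrier R; s \<in> carrier R\<rbrakk> \<Longrightarrow>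
      \<delta> (r \<otimes>\<^bsub>R\<^esub> s) = \<delta> r \<otimes>\<^bsub>R\<^esub> s \<oplus>\<^bsub>R\<^esub> r \<otimes>\<^bsub>R\<^esub> \<delta> s"
  using assms unfolding derivation_def by blast+

text \<open>Additivity handles differences. For a multiple \<open>x r\<close>, both Leibniz terms
  \<open>\<delta> x r\<close> and \<open>x \<delta> r\<close> lie in \<open>I\<close>, since
  \<open>\<delta> x\<close> and \<open>x\<close> do and \<open>I\<close> absorbs on the
  right.\<close>

lemma right_ideal_derivation:
  assumes "ring T" and I: "right_ideal I T" and d: "derivation T \<delta>"
  shows "right_ideal {x \<in> I. \<delta> x \<in> I} T"
proof (rule right_idealI)
  interpret T: ring T by fact
  interpret I: additive_subgroup I T
    using I by (simp add: right_ideal_def)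
  show "abelian_group T" by (rule T.abelian_group_axioms)
  show "{x \<in> I. \<delta> x \<in> I} \<subseteq> carrier T" by auto
  note closed = derivationD(1)[OF d] and add = derivationD(2)[OF d]
  \<comment> \<open>Additivity at \<open>0 + 0\<close>, followed by cancellation.\<close>
  have zero: "\<delta> \<zero>\<^bsub>T\<^esub> = \<zero>\<^bsub>T\<^esub>"
  proof -
    have "\<delta> \<zero>\<^bsub>T\<^esub> \<oplus>\<^bsub>T\<^esub> \<delta> \<zero>\<^bsub>T\<^esub> = \<delta> \<zero>\<^bsub>T\<^esub>"
      using add[OF T.zero_closed T.zero_closed, symmetric]
      by (simp only: T.l_zero T.zero_closed)
    then show ?thesis
      using T.add.l_cancel_one[OF closed closed, OF T.zero_closed T.zero_closed] by simp
  qed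
  have inv: "\<delta> (\<ominus>\<^bsub>T\<^esub> x) = \<ominus>\<^bsub>T\<^esub> \<delta> x" if "x \<in> carrier T" for x
  proof (rule T.minus_equality[symmetric])
    show "\<delta> (\<ominus>\<^bsub>T\<^esub> x) \<oplus>\<^bsub>T\<^esub> \<delta> x = \<zero>\<^bsub>T\<^esub>"
      using that zero add[of "\<ominus>\<^bsub>T\<^esub> x" x] by (simp add: T.l_neg)
  qed (simp_all add: that closed)
  show "{x \<in> I. \<delta> x \<in> I} \<noteq> {}"
    using zero I.zero_closed by (auto intro!: exI[of _ "\<zero>\<^bsub>T\<^esub>"])
  show "x \<ominus>\<^bsub>T\<^esub> y \<in> {x \<in> I. \<delta> x \<in> I}"
    if "x \<in> {x \<in> I. \<delta> x \<in> I}" "y \<in> {x \<in> I. \<delta> x \<in> I}" for x y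
  proof -
    have xy: "x \<in> I" "y \<in> I" "\<delta> x \<in> I" "\<delta> y \<in> I"
      using that by blast+
    then have "\<delta> (x \<ominus>\<^bsub>T\<^esub> y) = \<delta> x \<ominus>\<^bsub>T\<^esub> \<delta> y"
      by (simp add: a_minus_def add inv)
    then show ?thesis
      using xy by (simp add: a_minus_def)
  qed
  show "x \<otimes>\<^bsub>T\<^esub> r \<in> {x \<in> I. \<delta> x \<in> I}" if "x \<in> {x \<in> I. \<delta> x \<in> I}" "r \<in> carrier T" for x r
  proof -
    have x: "x \<in> I" "\<delta> x \<in> I" using that by blast+
    have "\<delta> (x \<otimes>\<^bsub>T\<^esub> r) = \<delta> x \<otimes>\<^bsub>T\<^esub> r \<oplus>\<^bsub>T\<^esub> x \<otimes>\<^bsub>T\<^esub> \<delta> r"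
      by (rule derivationD(3)[OF d I.a_Hcarr[OF x(1)] that(2)])
    also have "\<dots> \<in> I"
      by (intro I.a_closed right_idealD(2)[OF I] x that closed)
    finally show ?thesis
      using right_idealD(2)[OF I x(1) that(2)] by blast
  qed
qed

section \<open>Colon ideals along a ring homomorphism\<close>

context
  fixes A :: "('a, 'm) ring_scheme" and T :: "('t, 'n) ring_scheme" and h :: "'a \<Rightarrow> 't"
    and I :: "'t set"
  assumes rings: "ring A" "ring T" and h: "h \<in> ring_hom A T" and I: "right_ideal I T"
begin

interpretation h: ring_hom_ring A T h
  by (intro ring_hom_ringI2 rings h)

interpretation I: additive_subgroup I T
  using I by (simp add: right_ideal_def)

text \<open>For \<open>h\<close> the identity this set is the usual colon ideal, and for
  \<open>t = \<one>\<close> the preimage of \<open>I\<close>. Absorption comes from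
  \<open>t h (x r) = (t h x) h r\<close>.\<close>

lemma right_ideal_hom_colon:
  assumes "t \<in> carrier T"
  shows "right_ideal {r \<in> carrier A. t \<otimes>\<^bsub>T\<^esub> h r \<in> I} A"
proof (rule right_idealI)
  show "{r \<in> carrier A. t \<otimes>\<^bsub>T\<^esub> h r \<in> I} \<noteq> {}"
    using assms h.hom_zero I.zero_closed by force
  show "x \<ominus>\<^bsub>A\<^esub> y \<in> {r \<in> carrier A. t \<otimes>\<^bsub>T\<^esub> h r \<in> I}"
    if "x \<in> {r \<in> carrier A. t \<otimes>\<^bsub>T\<^esub> h r \<in> I}" "y \<in> {r \<in> carrier A. t \<otimes>\<^bsub>T\<^esub> h r \<in> I}" for x y
    using that assms
    by (auto simp: a_minus_def h.S.r_distr h.S.r_minus)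
  show "x \<otimes>\<^bsub>A\<^esub> r \<in> {r \<in> carrier A. t \<otimes>\<^bsub>T\<^esub> h r \<in> I}"
    if "x \<in> {r \<in> carrier A. t \<otimes>\<^bsub>T\<^esub> h r \<in> I}" "r \<in> carrier A" for x r
    using that assms I by (auto simp: right_ideal_def simp flip: h.S.m_assoc)
qed (auto simp: h.R.abelian_group_axioms)

text \<open>The colon ideal at a difference contains the intersection of the two given ones. This is
  the difference case of the inductions over tensors.\<close>

lemma gabriel_filter_colon_diff:
  assumes F: "right_gabriel_filter A F" and xy: "x \<in> carrier T" "y \<in> carrier T"
    and "{r \<in> carrier A. x \<otimes>\<^bsub>T\<^esub> h r \<in> I} \<in> F" "{r \<in> carrier A. y \<otimes>\<^bsub>T\<^esub> h r \<in> I} \<in> F"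
  shows "{r \<in> carrier A. (x \<ominus>\<^bsub>T\<^esub> y) \<otimes>\<^bsub>T\<^esub> h r \<in> I} \<in> F"
proof (rule right_gabriel_filterD(3)[OF F])
  show "{r \<in> carrier A. x \<otimes>\<^bsub>T\<^esub> h r \<in> I} \<inter> {r \<in> carrier A. y \<otimes>\<^bsub>T\<^esub> h r \<in> I} \<in> F"
    using assms by (intro right_gabriel_filterD(4)[OF F])
  show "{r \<in> carrier A. x \<otimes>\<^bsub>T\<^esub> h r \<in> I} \<inter> {r \<in> carrier A. y \<otimes>\<^bsub>T\<^esub> h r \<in> I} \<subseteq>
      {r \<in> carrier A. (x \<ominus>\<^bsub>T\<^esub> y) \<otimes>\<^bsub>T\<^esub> h r \<in> I}"
    using xy by (intro subsetI) (simp add: a_minus_def h.S.l_distr h.S.l_minus)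
  show "right_ideal {r \<in> carrier A. (x \<ominus>\<^bsub>T\<^esub> y) \<otimes>\<^bsub>T\<^esub> h r \<in> I} A"
    using xy by (intro right_ideal_hom_colon h.S.minus_closed)
qed

text \<open>The set is all of \<open>carrier A\<close>, which belongs to every nonempty upward
  closed family of right ideals.\<close>

lemma gabriel_filter_colon_zero:
  assumes F: "right_gabriel_filter A F"
  shows "{r \<in> carrier A. \<zero>\<^bsub>T\<^esub> \<otimes>\<^bsub>T\<^esub> h r \<in> I} \<in> F"
proof -
  obtain K where K: "K \<in> F"
    using right_gabriel_filterD(1)[OF F] by blast
  interpret K: additive_subgroup K A
    by (intro right_idealD right_gabriel_filterD(2)[OF F] K)
  show ?thesis
  proof (rule right_gabriel_filterD(3)[OF F K])
    show "K \<subseteq> {r \<in> carrier A. \<zero>\<^bsub>T\<^esub> \<otimes>\<^bsub>T\<^esub> h r \<in> I}"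
      using K.a_Hcarr by (intro subsetI) simp
  qed (rule right_ideal_hom_colon[OF h.S.zero_closed])
qed

end

text \<open>The filter lives on \<open>A\<close> but the derivation on \<open>T\<close>, and no
  derivation of \<open>A\<close> is involved. The hypothesis \<open>colon\<close> bridges the two:
  it covers every \<open>t\<close> in \<open>T\<close>, in particular \<open>\<delta> (h a)\<close>,
  which may lie outside the image of \<open>h\<close>.\<close>

lemma gabriel_filter_derivation:
  assumes rings: "ring A" "ring T" and h: "h \<in> ring_hom A T" and I: "right_ideal I T"
    and F: "right_gabriel_filter A F"
    and colon: "\<And>t. t \<in> carrier T \<Longrightarrow> {r \<in> carrier A. t \<otimes>\<^bsub>T\<^esub> h r \<in> I} \<in> F"
    and d: "derivation T \<delta>"
  shows "{r \<in> carrier A. h r \<in> I \<and> \<delta> (h r) \<in> I} \<in> F" (is "?J \<in> F")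
proof -
  interpret h: ring_hom_ring A T h
    by (intro ring_hom_ringI2 rings h)
  \<comment> \<open>\<open>?K\<close> is the preimage of \<open>I\<close>, written as a colon ideal
    at \<open>\<one>\<close> so that \<open>colon\<close> puts it in \<open>F\<close>. The local
    criterion for \<open>?J\<close> is then tested at the elements of \<open>?K\<close>.\<close>
  let ?L = "{x \<in> I. \<delta> x \<in> I}" and ?K = "{r \<in> carrier A. \<one>\<^bsub>T\<^esub> \<otimes>\<^bsub>T\<^esub> h r \<in> I}"
  have L: "right_ideal ?L T"
    by (rule right_ideal_derivation[OF rings(2) I d])
  note closed = derivationD(1)[OF d]
  have I_mult: "x \<otimes>\<^bsub>T\<^esub> y \<in> I" if "x \<in> I" "y \<in> carrier T" for x y
    using that by (rule right_idealD[OF I])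
  have I_add: "x \<oplus>\<^bsub>T\<^esub> y \<in> I" if "x \<in> I" "y \<in> I" for x y
    using that by (rule additive_subgroup.a_closed[OF right_idealD(1)[OF I]])
  have "right_colon A ?J a \<in> F" if a: "a \<in> ?K" for a
  proof -
    have ha: "a \<in> carrier A" "h a \<in> carrier T" "h a \<in> I"
      using a by auto
    have eq: "right_colon A ?J a = {r \<in> carrier A. h a \<otimes>\<^bsub>T\<^esub> h r \<in> ?L}"
      unfolding right_colon_def using ha(1) by auto
    have "right_ideal (right_colon A ?J a) A"
      unfolding eq by (rule right_ideal_hom_colon[OF rings h L ha(2)])
    \<comment> \<open>Only the first Leibniz term constrains \<open>r\<close>: the second,
      \<open>h a\<close> times \<open>\<delta> (h r)\<close>, is in \<open>I\<close> because
      \<open>h a\<close> is.\<close>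
    moreover have "{r \<in> carrier A. \<delta> (h a) \<otimes>\<^bsub>T\<^esub> h r \<in> I} \<subseteq> right_colon A ?J a"
    proof
      fix r assume "r \<in> {r \<in> carrier A. \<delta> (h a) \<otimes>\<^bsub>T\<^esub> h r \<in> I}"
      then have r: "r \<in> carrier A" "h r \<in> carrier T" "\<delta> (h a) \<otimes>\<^bsub>T\<^esub> h r \<in> I"
        by simp_all
      have "\<delta> (h a \<otimes>\<^bsub>T\<^esub> h r) = \<delta> (h a) \<otimes>\<^bsub>T\<^esub> h r \<oplus>\<^bsub>T\<^esub> h a \<otimes>\<^bsub>T\<^esub> \<delta> (h r)"
        by (rule derivationD(3)[OF d ha(2) r(2)])
      also have "\<dots> \<in> I"
        by (rule I_add[OF r(3) I_mult[OF ha(3) closed[OF r(2)]]])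
      finally show "r \<in> right_colon A ?J a"
        using r(1,2) ha I_mult unfolding right_colon_def by simp
    qed
    ultimately show ?thesis
      by (rule right_gabriel_filterD(3)[OF F colon[OF closed[OF ha(2)]], rotated])
  qed
  \<comment> \<open>Again a preimage in the form of a colon ideal at \<open>\<one>\<close>, now of
    \<open>?L\<close>.\<close>
  moreover have eq: "?J = {r \<in> carrier A. \<one>\<^bsub>T\<^esub> \<otimes>\<^bsub>T\<^esub> h r \<in> ?L}"
    by auto
  have "right_ideal ?J A"
    unfolding eq by (rule right_ideal_hom_colon[OF rings h L h.S.one_closed])
  ultimately show ?thesis
    by (rule right_gabriel_filterD(6)[OF F colon[OF h.S.one_closed], rotated])
qed

section \<open>Colon ideals and pure tensors in the tensor product\<close>

context
  fixes A :: "('a, 'm) ring_scheme" and B :: "('b, 'n) ring_scheme"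
  fixes I :: "('a \<times> 'b \<Rightarrow>\<^sub>0 int) set set"
  assumes rings: "ring A" "ring B" and I: "right_ideal I (tensor_ring A B)"
begin

text \<open>Supplies the hypothesis \<open>colon\<close> of
  \<open>gabriel_filter_derivation\<close>. Since
  \<open>(a \<otimes> b) (r \<otimes> 1) = a r \<otimes> b\<close>, the colon ideal at a pure tensor
  contains \<open>right_colon A J a\<close>; other tensors follow by differences.\<close>

lemma tensor_colon_left:
  assumes F: "right_gabriel_filter A F" and J: "J \<in> F"
    and sub: "\<And>a b. a \<in> J \<Longrightarrow> b \<in> carrier B \<Longrightarrow> pure_tensor A B a b \<in> I"
    and t: "t \<in> carrier (tensor_ring A B)"
  shows "{r \<in> carrier A. t \<otimes>\<^bsub>tensor_ring A B\<^esub> pure_tensor A B r \<one>\<^bsub>B\<^esub> \<in> I} \<in> F"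
proof -
  interpret A: ring A by (fact rings)
  interpret B: ring B by (fact rings)
  note hom = rings(1) ring_tensor_ring[OF rings] pure_tensor_left_hom[OF rings] I
  show ?thesis
    using t
  proof (induction t rule: tensor_ring_induct[OF rings, consumes 1, case_names zero pure diff])
    case zero
    show ?case
      by (rule gabriel_filter_colon_zero[OF hom F])
  next
    case (pure a b)
    have "right_colon A J a \<in> F"
      using pure by (intro right_gabriel_filterD(5)[OF F J])
    moreover have "right_colon A J a \<subseteq>
        {r \<in> carrier A. pure_tensor A B a b \<otimes>\<^bsub>tensor_ring A B\<^esub> pure_tensor A B r \<one>\<^bsub>B\<^esub> \<in> I}"
      using pure sub by (auto simp: right_colon_def pure_tensor_mult[OF rings])
    ultimately show ?case
      by (rule right_gabriel_filterD(3)[OF F _ _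
            right_ideal_hom_colon[OF hom pure_tensor_closed[OF rings pure]]])
  next
    case (diff x y)
    then show ?case
      by (intro gabriel_filter_colon_diff[OF hom F])
  qed
qed

text \<open>The mirror case, from \<open>(a \<otimes> b) (1 \<otimes> r) = a \<otimes> b r\<close>
  with the product \<open>b r\<close> formed in \<open>B\<close>. When \<open>B\<close> is an
  opposite ring, this serves a filter of left ideals.\<close>

lemma tensor_colon_right:
  assumes F: "right_gabriel_filter B G" and J: "J \<in> G"
    and sub: "\<And>a b. a \<in> carrier A \<Longrightarrow> b \<in> J \<Longrightarrow> pure_tensor A B a b \<in> I"
    and t: "t \<in> carrier (tensor_ring A B)"
  shows "{r \<in> carrier B. t \<otimes>\<^bsub>tensor_ring A B\<^esub> pure_tensor A B \<one>\<^bsub>A\<^esub> r \<in> I} \<in> G"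
proof -
  interpret A: ring A by (fact rings)
  interpret B: ring B by (fact rings)
  note hom = rings(2) ring_tensor_ring[OF rings] pure_tensor_right_hom[OF rings] I
  show ?thesis
    using t
  proof (induction t rule: tensor_ring_induct[OF rings, consumes 1, case_names zero pure diff])
    case zero
    show ?case
      by (rule gabriel_filter_colon_zero[OF hom F])
  next
    case (pure a b)
    have "right_colon B J b \<in> G"
      using pure by (intro right_gabriel_filterD(5)[OF F J])
    moreover have "right_colon B J b \<subseteq>
        {r \<in> carrier B. pure_tensor A B a b \<otimes>\<^bsub>tensor_ring A B\<^esub> pure_tensor A B \<one>\<^bsub>A\<^esub> r \<in> I}"
      using pure sub by (auto simp: right_colon_def pure_tensor_mult[OF rings])
    ultimately show ?case
      by (rule right_gabriel_filterD(3)[OF F _ _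
            right_ideal_hom_colon[OF hom pure_tensor_closed[OF rings pure]]])
  next
    case (diff x y)
    then show ?case
      by (intro gabriel_filter_colon_diff[OF hom F])
  qed
qed

text \<open>Reduces the condition in \<open>induced_symmetric_filter\<close> to pure tensors: they
  generate both images, and \<open>I\<close> is closed under addition.\<close>

lemma tensor_image_sum_subset_iff:
  assumes "additive_subgroup X A" "additive_subgroup Y B"
  shows "tensor_image A B X (carrier B) <+>\<^bsub>tensor_ring A B\<^esub> tensor_image A B (carrier A) Y \<subseteq> I \<longleftrightarrow>
    (\<forall>x\<in>X. \<forall>b\<in>carrier B. pure_tensor A B x b \<in> I) \<and>
    (\<forall>a\<in>carrier A. \<forall>y\<in>Y. pure_tensor A B a y \<in> I)" (is "?L \<longleftrightarrow> ?R")
proof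
  interpret A: ring A by (fact rings)
  interpret B: ring B by (fact rings)
  interpret T: ring "tensor_ring A B" by (rule ring_tensor_ring[OF rings])
  interpret I: additive_subgroup I "tensor_ring A B"
    using I by (simp add: right_ideal_def)
  have sub: "X \<subseteq> carrier A" "Y \<subseteq> carrier B"
    using assms by (auto dest: additive_subgroup.a_subset)
  \<comment> \<open>Each summand embeds in the sum set by adding the zero of the other one.\<close>
  have zero: "\<zero>\<^bsub>tensor_ring A B\<^esub> \<in> tensor_image A B U V" for U V
    unfolding tensor_image_def using generate.one[of "add_monoid (tensor_ring A B)"] by simp
  have incl: "pure_tensor A B x y \<in> tensor_image A B U V" if "x \<in> U" "y \<in> V" for x y U V
    unfolding tensor_image_def using that by (auto intro: generate.incl)
  {
    assume L: ?L
    have "pure_tensor A B x b \<oplus>\<^bsub>tensor_ring A B\<^esub> \<zero>\<^bsub>tensor_ring A B\<^esub> \<in> I"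
      if "x \<in> X" "b \<in> carrier B" for x b
      using L zero incl[OF that] by (fastforce simp: set_add_def')
    moreover have "\<zero>\<^bsub>tensor_ring A B\<^esub> \<oplus>\<^bsub>tensor_ring A B\<^esub> pure_tensor A B a y \<in> I"
      if "a \<in> carrier A" "y \<in> Y" for a y
      using L zero incl[OF that] by (fastforce simp: set_add_def')
    ultimately show ?R
      using sub pure_tensor_closed[OF rings] by (metis T.l_zero T.r_zero subsetD)
  }
  assume R: ?R
  have "tensor_image A B X (carrier B) \<subseteq> I"
    unfolding tensor_image_def
    by (rule generate_subset_additive_subgroup[OF T.abelian_group_axioms
        I.additive_subgroup_axioms])
      (use R in blast)
  moreover have "tensor_image A B (carrier A) Y \<subseteq> I"
    unfolding tensor_image_def
    by (rule generate_subset_additive_subgroup[OF T.abelian_group_axioms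
        I.additive_subgroup_axioms])
      (use R in blast)
  ultimately show ?L
    unfolding set_add_def' by (blast intro: I.a_closed)
qed

end

section \<open>Symmetric filters and derivations of the enveloping ring\<close>

lemma symmetric_filter_differential:
  assumes "ring R" "symmetric_filter R F"
  shows "differential_filter R F"
  unfolding differential_filter_def
proof (intro ballI allI impI)
  let ?S = "opposite_ring R" and ?T = "env_ring R"
  fix K \<delta> assume K: "K \<in> F" and d: "derivation ?T \<delta>"
  interpret R: ring R by fact
  have rings: "ring R" "ring ?S"
    using assms(1) by (auto intro: ring_opposite_ring)
  interpret T: ring ?T by (rule ring_tensor_ring[OF rings])
  obtain Fl Fr where Fl: "right_gabriel_filter ?S Fl" and Fr: "right_gabriel_filter R Fr"
    and F: "F = induced_symmetric_filter R Fl Fr"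
    using assms(2) unfolding symmetric_filter_def left_gabriel_filter_eq by blast
  note left_subgroup = right_idealD(1)[OF right_gabriel_filterD(2)[OF Fl]]
    and right_subgroup = right_idealD(1)[OF right_gabriel_filterD(2)[OF Fr]]
  obtain I J where "I \<in> Fl" "J \<in> Fr" and rK: "right_ideal K ?T"
    and "tensor_image R ?S J (carrier R) <+>\<^bsub>?T\<^esub> tensor_image R ?S (carrier R) I \<subseteq> K"
    using K F unfolding induced_symmetric_filter_def by blast
  then have JI: "\<And>x b. x \<in> J \<Longrightarrow> b \<in> carrier ?S \<Longrightarrow> env_pure R x b \<in> K"
      "\<And>a y. a \<in> carrier R \<Longrightarrow> y \<in> I \<Longrightarrow> env_pure R a y \<in> K"
    using tensor_image_sum_subset_iff[OF rings rK right_subgroup[OF \<open>J \<in> Fr\<close>]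
        left_subgroup[OF \<open>I \<in> Fl\<close>]]
    by simp_all
  \<comment> \<open>The witness, depending on \<open>\<delta>\<close>. It is mapped into
    \<open>K\<close> by construction, so what remains is its membership in \<open>F\<close>.\<close>
  let ?L = "{x \<in> K. \<delta> x \<in> K}"
  have rL: "right_ideal ?L ?T"
    by (rule right_ideal_derivation[OF T.ring_axioms rK d])
  \<comment> \<open>\<open>J'\<close> and \<open>I'\<close> are the preimages of \<open>?L\<close>
    under the two embeddings, in the form in which \<open>gabriel_filter_derivation\<close> delivers
    them; they will witness that \<open>?L\<close> is in the induced filter.\<close>
  define J' where "J' = {r \<in> carrier R. env_pure R r \<one>\<^bsub>?S\<^esub> \<in> K \<and> \<delta> (env_pure R r \<one>\<^bsub>?S\<^esub>) \<in> K}"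
  define I' where "I' = {r \<in> carrier ?S. env_pure R \<one>\<^bsub>R\<^esub> r \<in> K \<and> \<delta> (env_pure R \<one>\<^bsub>R\<^esub> r) \<in> K}"
  have J': "J' \<in> Fr"
    unfolding J'_def
    by (rule gabriel_filter_derivation[OF rings(1) T.ring_axioms pure_tensor_left_hom[OF rings] rK
          Fr tensor_colon_left[OF rings rK Fr \<open>J \<in> Fr\<close> JI(1)] d])
  have I': "I' \<in> Fl"
    unfolding I'_def
    by (rule gabriel_filter_derivation[OF rings(2) T.ring_axioms pure_tensor_right_hom[OF rings] rK
          Fl tensor_colon_right[OF rings rK Fl \<open>I \<in> Fl\<close> JI(2)] d])
  have closed: "x \<otimes>\<^bsub>?T\<^esub> t \<in> ?L" if "x \<in> ?L" "t \<in> carrier ?T" for x t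
    using that by (rule right_idealD(2)[OF rL])
  have "env_pure R x b \<in> ?L" if "x \<in> J'" "b \<in> carrier R" for x b
  proof -
    have x: "x \<in> carrier R" "env_pure R x \<one>\<^bsub>?S\<^esub> \<in> ?L"
      using that(1) unfolding J'_def by blast+
    \<comment> \<open>The factor known to lie in \<open>?L\<close> stands on the left, because
      \<open>?L\<close> absorbs only on the right.\<close>
    have eq: "env_pure R x \<one>\<^bsub>?S\<^esub> \<otimes>\<^bsub>?T\<^esub> env_pure R \<one>\<^bsub>R\<^esub> b = env_pure R x b"
      using x(1) that(2) by (simp add: pure_tensor_mult[OF rings])
    have "env_pure R \<one>\<^bsub>R\<^esub> b \<in> carrier ?T"
      using that(2) by (simp add: pure_tensor_closed[OF rings])
    from closed[OF x(2) this] show ?thesis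
      unfolding eq .
  qed
  moreover have "env_pure R a y \<in> ?L" if "a \<in> carrier R" "y \<in> I'" for a y
  proof -
    have y: "y \<in> carrier R" "env_pure R \<one>\<^bsub>R\<^esub> y \<in> ?L"
      using that(2) unfolding I'_def opposite_ring_simps by blast+
    \<comment> \<open>Elements \<open>a \<otimes> 1\<close> and \<open>1 \<otimes> y\<close>
      commute, so here too the factor from \<open>?L\<close> can be placed on the left.\<close>
    have eq: "env_pure R \<one>\<^bsub>R\<^esub> y \<otimes>\<^bsub>?T\<^esub> env_pure R a \<one>\<^bsub>?S\<^esub> = env_pure R a y"
      using y(1) that(1) by (simp add: pure_tensor_mult[OF rings])
    have "env_pure R a \<one>\<^bsub>?S\<^esub> \<in> carrier ?T"
      using that(1) by (simp add: pure_tensor_closed[OF rings])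
    from closed[OF y(2) this] show ?thesis
      unfolding eq .
  qed
  ultimately have "tensor_image R ?S J' (carrier R) <+>\<^bsub>?T\<^esub> tensor_image R ?S (carrier R) I' \<subseteq> ?L"
    using tensor_image_sum_subset_iff[OF rings rL right_subgroup[OF J'] left_subgroup[OF I']]
    by simp
  then have "?L \<in> F"
    using rL I' J' unfolding F induced_symmetric_filter_def by blast
  then show "\<exists>J\<in>F. \<delta> ` J \<subseteq> K"
    by (rule bexI[rotated]) auto
qed

theorem corollary4:
  fixes R :: "('a, 'm) ring_scheme" and F :: "'a env set set"
  assumes "ring R"
    and "symmetric_filter R F"
    and "perfect_filter TYPE('s) R F"
  shows "differential_filter R F"
  using assms(1,2) by (rule symmetric_filter_differential)

end
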